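(* Let $\mathbb{F}$ be a finite field and $\alpha\in\mathbb{F}$ with $\mathrm{ord}(\alpha)=n$. Define $H_{\min}\in\mathbb{F}[z]^{(n-1)\times n}$ as the matrix whose entry in row $j$ ($j=1,\ldots,n-1$) and column $\nu$ ($\nu=1,\ldots,n$) is $(\alpha^{n-\nu+1})^{j-1}z-(\alpha^{n-\nu+1})^j$. Then $H_{\min}$ is minimal and right invertible, and $G H_{\min}^{\mathsf T}=0$ where $G=\sum_{\nu=0}^{n-1}z^\nu\begin{pmatrix}1&\alpha^\nu&\alpha^{2\nu}&\ldots&\alpha^{(n-1)\nu}\end{pmatrix}\in\mathbb{F}[z]^{1\times n}$. Consequently $H_{\min}$ is a parity check matrix of the convolutional code $\mathrm{im}\,G$, i.e. $\mathrm{im}\,G=\{v\in\mathbb{F}[z]^n\mid vH_{\min}^{\mathsf T}=0\}$.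
   Context: $\mathrm{ord}(\alpha)$ is the multiplicative order of $\alpha$. A polynomial matrix $M\in\mathbb{F}[z]^{k\times n}$ is right invertible if $M\tilde M=I_k$ for some $\tilde M\in\mathbb{F}[z]^{n\times k}$. A full-row-rank matrix $M\in\mathbb{F}[z]^{k\times n}$ is minimal (a minimal basis in Forney's sense) if the sum of its row degrees is minimal among all polynomial matrices whose rows form a basis of the $\mathbb{F}[z]$-module $\mathrm{im}\,M$; equivalently, the matrix of coefficients of the highest row-degree terms has full row rank. A parity check matrix of $\mathcal{C}=\mathrm{im}\,G$ is a right invertible $H$ with $\mathcal{C}=\{v\mid vH^{\mathsf T}=0\}$. *)

theory Defs
  imports "HOL-Computational_Algebra.Polynomial" "Jordan_Normal_Form.Matrix"
begin

definition mult_ord :: "'a::field \<Rightarrow> nat" where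
  "mult_ord a = (if a = 0 then 0 else (LEAST k. 0 < k \<and> a ^ k = 1))"

definition row_mult :: "'a::semiring_0 vec \<Rightarrow> 'a mat \<Rightarrow> 'a vec" where
  "row_mult u M = vec (dim_col M) (\<lambda>j. \<Sum>i<dim_row M. u $ i * M $$ (i, j))"

definition row_image :: "'a::field poly mat \<Rightarrow> 'a poly vec set" where
  "row_image M = {row_mult u M | u. u \<in> carrier_vec (dim_row M)}"

definition right_invertible :: "'a::field poly mat \<Rightarrow> bool" where
  "right_invertible M \<longleftrightarrow>
     (\<exists>Mt \<in> carrier_mat (dim_col M) (dim_row M). M * Mt = 1\<^sub>m (dim_row M))"

definition full_row_rank :: "'a::field poly mat \<Rightarrow> bool" where
  "full_row_rank M \<longleftrightarrow>
     (\<forall>u \<in> carrier_vec (dim_row M). row_mult u M = 0\<^sub>v (dim_col M) \<longrightarrow> u = 0\<^sub>v (dim_row M))"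

definition row_degree :: "'a::zero poly mat \<Rightarrow> nat \<Rightarrow> nat" where
  "row_degree M i = Max (insert 0 {degree (M $$ (i, j)) | j. j < dim_col M})"

definition sum_row_degrees :: "'a::zero poly mat \<Rightarrow> nat" where
  "sum_row_degrees M = (\<Sum>i<dim_row M. row_degree M i)"

definition rows_basis_of :: "'a::field poly mat \<Rightarrow> 'a poly mat \<Rightarrow> bool" where
  "rows_basis_of B M \<longleftrightarrow> dim_col B = dim_col M \<and> full_row_rank B \<and> row_image B = row_image M"

text \<open>Minimal basis in Forney's sense.\<close>
definition minimal_mat :: "'a::field poly mat \<Rightarrow> bool" where
  "minimal_mat M \<longleftrightarrow> full_row_rank M \<and>
     (\<forall>B. rows_basis_of B M \<longrightarrow> sum_row_degrees M \<le> sum_row_degrees B)"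

definition parity_check_mat :: "'a::field poly mat \<Rightarrow> 'a poly vec set \<Rightarrow> bool" where
  "parity_check_mat H C \<longleftrightarrow> right_invertible H \<and>
     C = {v \<in> carrier_vec (dim_col H). row_mult v (transpose_mat H) = 0\<^sub>v (dim_row H)}"

text \<open>H_min (0-indexed: row i = j-1, column c = nu-1, beta = alpha^(n-c)).\<close>
definition H_min :: "'a::field \<Rightarrow> nat \<Rightarrow> 'a poly mat" where
  "H_min \<alpha> n = mat (n - 1) n
     (\<lambda>(i, c). [: - ((\<alpha> ^ (n - c)) ^ (i + 1)), (\<alpha> ^ (n - c)) ^ i :])"

definition G_mat :: "'a::field \<Rightarrow> nat \<Rightarrow> 'a poly mat" where
  "G_mat \<alpha> n = mat 1 n (\<lambda>(_, c). \<Sum>\<nu><n. monom ((\<alpha> ^ \<nu>) ^ c) \<nu>)"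

end

(* H_min is the Vandermonde matrix of the n-th roots of unity beta_c = alpha^(n-c), without its last
   row, times the diagonal matrix diag(z - beta_c). Hence everything is settled by the discrete
   Fourier transform, which is invertible because n is nonzero in the field: a kernel vector v has
   v_c (z - beta_c) = beta_c mu for a single polynomial mu, which must vanish at all beta_c, so that
   z^n - 1 divides mu, while the entries of G are G_c = beta_c (z^n - 1) / (z - beta_c). *)
theory Submission
  imports Defs "Jordan_Normal_Form.Determinant"
begin

hide_const (open) Module.smult

section \<open>Right inverses, row modules and row degrees\<close>

text \<open>If m < k, padding A with zero columns and B with zero rows gives square matrices with
  the same product, so their determinants multiply to 1, although the padded B has a zero
  row.\<close>

lemma right_inverse_imp_rows_le_cols:
  fixes A :: "'a::idom mat"
  assumes A: "A \<in> carrier_mat k m" and B: "B \<in> carrier_mat m k" and AB: "A * B = 1\<^sub>m k"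
  shows "k \<le> m"
proof (rule ccontr)
  assume "\<not> k \<le> m"
  hence mk: "m < k" by simp
  define A' where "A' = mat k k (\<lambda>(i, j). if j < m then A $$ (i, j) else 0)"
  define B' where "B' = mat k k (\<lambda>(i, j). if i < m then B $$ (i, j) else 0)"
  have carr: "A' \<in> carrier_mat k k" "B' \<in> carrier_mat k k"
    by (auto simp: A'_def B'_def)
  have "A' * B' = A * B"
  proof (rule eq_matI)
    fix i j assume "i < dim_row (A * B)" "j < dim_col (A * B)"
    hence ij: "i < k" "j < k" using A B by auto
    have "(\<Sum>l = 0..<k. A' $$ (i, l) * B' $$ (l, j)) = (\<Sum>l = 0..<m. A $$ (i, l) * B $$ (l, j))"
      by (rule sum.mono_neutral_cong_right) (use mk ij in \<open>auto simp: A'_def B'_def\<close>)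
    thus "(A' * B') $$ (i, j) = (A * B) $$ (i, j)"
      using ij A B carr by (auto simp: scalar_prod_def)
  qed (use A B carr in auto)
  hence "det A' * det B' = 1"
    using det_mult[OF carr] AB by simp
  moreover have "det B' = 0"
    \<comment> \<open>Row m is the first padded one; it exists because m < k.\<close>
    by (subst laplace_expansion_row[OF carr(2), of m]) (use mk in \<open>auto simp: B'_def\<close>)
  ultimately show False by simp
qed

lemma smult_sum_right: "smult a (\<Sum>i\<in>S. f i) = (\<Sum>i\<in>S. smult a (f i))"
  by (induction S rule: infinite_finite_induct) (simp_all add: smult_add_right)

lemma row_mult_unit_vec:
  fixes M :: "'a::semiring_1 mat"
  assumes "i < dim_row M"
  shows "row_mult (unit_vec (dim_row M) i) M = row M i"
proof (rule eq_vecI)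
  fix j assume j: "j < dim_vec (row M i)"
  have "(\<Sum>l<dim_row M. unit_vec (dim_row M) i $ l * M $$ (l, j)) =
      (\<Sum>l<dim_row M. if l = i then M $$ (l, j) else 0)"
    by (rule sum.cong) (use assms in \<open>auto simp: unit_vec_def\<close>)
  also have "\<dots> = M $$ (i, j)" using assms by simp
  finally show "row_mult (unit_vec (dim_row M) i) M $ j = row M i $ j"
    using assms j by (simp add: row_mult_def)
qed (simp add: row_mult_def)

lemma row_in_row_image:
  assumes "i < dim_row M"
  shows "row M i \<in> row_image M"
  unfolding row_image_def using row_mult_unit_vec[OF assms] by (metis (mono_tags, lifting) mem_Collect_eq unit_vec_carrier)

text \<open>A zero row would put a unit vector into the left kernel.\<close>

lemma full_row_rank_row_nonzero:
  assumes "full_row_rank M" "i < dim_row M"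
  shows "row M i \<noteq> 0\<^sub>v (dim_col M)"
proof
  assume "row M i = 0\<^sub>v (dim_col M)"
  hence "unit_vec (dim_row M) i = (0\<^sub>v (dim_row M) :: 'a poly vec)"
    using assms row_mult_unit_vec[OF assms(2)] unfolding full_row_rank_def
    by (metis unit_vec_carrier)
  thus False using assms(2) by (metis index_unit_vec(1) index_zero_vec(1) zero_neq_one)
qed

text \<open>The 0 inserted in \<open>row_degree\<close> keeps the maximum defined for a matrix
  without columns and does not affect upper bounds.\<close>

lemma row_degree_le_iff:
  "row_degree M i \<le> d \<longleftrightarrow> (\<forall>j<dim_col M. degree (M $$ (i, j)) \<le> d)"
proof -
  have "{degree (M $$ (i, j)) | j. j < dim_col M} = (\<lambda>j. degree (M $$ (i, j))) ` {..<dim_col M}"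
    by auto
  thus ?thesis unfolding row_degree_def by auto
qed

text \<open>Expressing the rows of M through those of B gives M = T B. A right inverse N of M then
  makes B N a right inverse of T, which bounds the rows of T by its columns. This is the rank bound
  behind minimality.\<close>

lemma dim_row_le_of_row_image:
  assumes inv: "right_invertible M" and sub: "row_image M \<subseteq> row_image B"
    and dc: "dim_col B = dim_col M"
  shows "dim_row M \<le> dim_row B"
proof -
  define k m n where "k = dim_row M" and "m = dim_row B" and "n = dim_col M"
  have M: "M \<in> carrier_mat k n" and B: "B \<in> carrier_mat m n"
    using dc by (auto simp: k_def m_def n_def)
  obtain N where N: "N \<in> carrier_mat n k" and MN: "M * N = 1\<^sub>m k"
    using inv unfolding right_invertible_def k_def n_def by auto
  have "\<forall>i<k. \<exists>u. u \<in> carrier_vec m \<and> row M i = row_mult u B"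
  proof (intro allI impI)
    fix i assume "i < k"
    hence "row M i \<in> row_image B" using row_in_row_image sub by (auto simp: k_def)
    thus "\<exists>u. u \<in> carrier_vec m \<and> row M i = row_mult u B"
      unfolding row_image_def m_def by auto
  qed
  then obtain t where t: "\<And>i. i < k \<Longrightarrow> t i \<in> carrier_vec m"
      "\<And>i. i < k \<Longrightarrow> row M i = row_mult (t i) B" by metis
  define T where "T = mat k m (\<lambda>(i, l). t i $ l)"
  have T: "T \<in> carrier_mat k m" by (simp add: T_def)
  have "M = T * B"
  proof (rule eq_matI)
    fix i j assume "i < dim_row (T * B)" "j < dim_col (T * B)"
    hence ij: "i < k" "j < n" using T B by auto
    have "M $$ (i, j) = row_mult (t i) B $ j" 
      using ij M t(2)[of i] by (metis carrier_matD index_row(1))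
    also have "\<dots> = (\<Sum>l<m. t i $ l * B $$ (l, j))"
      using ij B by (simp add: row_mult_def)
    also have "\<dots> = (T * B) $$ (i, j)"
      using ij T B by (auto simp: scalar_prod_def T_def atLeast0LessThan intro!: sum.cong)
    finally show "M $$ (i, j) = (T * B) $$ (i, j)" .
  qed (use T B M in auto)
  hence "T * (B * N) = 1\<^sub>m k" using MN assoc_mult_mat[OF T B N] by simp
  hence "k \<le> m" by (rule right_inverse_imp_rows_le_cols[OF T mult_carrier_mat[OF B N]])
  thus ?thesis by (simp only: k_def m_def)
qed

section \<open>Primitive roots of unity and their orthogonality relations\<close>

text \<open>Together the assumptions say that \<alpha> has order exactly n; distinctness of the
  first n powers is the form in which the order is used.\<close>

locale primitive_root =
  fixes \<alpha> :: "'a::field" and n :: nat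
  assumes n_pos: "n > 0" and root: "\<alpha> ^ n = 1"
    and inj_powers: "inj_on (\<lambda>k. \<alpha> ^ k) {..<n}"
begin

text \<open>This is \<alpha>^(-c) with a natural exponent, so powers of \<open>\<beta> c\<close> and
  of \<open>\<alpha> ^ c\<close> are the two mutually inverse Fourier kernels.\<close>

abbreviation \<beta> :: "nat \<Rightarrow> 'a" where "\<beta> c \<equiv> \<alpha> ^ (n - c)"

abbreviation lin :: "nat \<Rightarrow> 'a poly" where "lin c \<equiv> [:- \<beta> c, 1:]"

lemma power_root: "(\<alpha> ^ k) ^ n = 1"
  by (metis mult.commute power_mult power_one root)

lemma alpha_nonzero: "\<alpha> \<noteq> 0"
  using root n_pos by (auto simp: power_0_left)

lemma beta_inverse: "c \<le> n \<Longrightarrow> \<beta> c = inverse (\<alpha> ^ c)"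
  using root alpha_nonzero by (simp add: power_diff divide_inverse)

lemma inj_beta: "inj_on \<beta> {..<n}"
proof (rule inj_onI)
  fix c d assume cd: "c \<in> {..<n}" "d \<in> {..<n}" "\<beta> c = \<beta> d"
  hence "\<alpha> ^ c = \<alpha> ^ d" by (simp add: beta_inverse)
  thus "c = d" using cd inj_powers by (auto dest: inj_onD)
qed

text \<open>If n were 0 in the field, then 1 + X + ... + X^(n-1) would have n roots.\<close>
lemma of_nat_n_nonzero: "of_nat n \<noteq> (0::'a)"
proof
  assume n0: "of_nat n = (0::'a)"
  define p :: "'a poly" where "p = (\<Sum>i<n. monom 1 i)"
  have coeff: "poly.coeff p 0 = 1"
    using n_pos by (simp add: p_def coeff_sum)
  have deg: "degree p < n"
    unfolding p_def using n_pos degree_monom_eq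
    by (intro degree_sum_less) (auto intro: le_less_trans[OF degree_monom_le])
  have "p = 0"
  proof (rule poly_eqI_degree[of "(\<lambda>k. \<alpha> ^ k) ` {..<n}"])
    fix x assume "x \<in> (\<lambda>k. \<alpha> ^ k) ` {..<n}"
    then obtain k where x: "x = \<alpha> ^ k" by auto
    hence xn: "x ^ n = 1" by (simp add: power_root)
    have "poly p x = (\<Sum>i<n. x ^ i)" by (simp add: p_def poly_sum poly_monom)
    \<comment> \<open>At x = 1 the sum is n, which is 0 by assumption; at any other root of unity
      the geometric sum formula has numerator x^n - 1 = 0.\<close>
    also have "\<dots> = 0"
      using n0 xn by (cases "x = 1") (simp_all add: geometric_sum)
    finally show "poly p x = poly 0 x" by simp
  qed (use deg n_pos inj_powers in \<open>auto simp: card_image\<close>)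
  thus False using coeff by simp
qed

text \<open>The sum is geometric with ratio \<alpha>^(k-i), an n-th root of unity that equals 1 only
  for i = k.\<close>

lemma orthogonality:
  assumes "i < n" "k < n"
  shows "(\<Sum>c<n. (\<alpha> ^ c) ^ k * \<beta> c ^ i) = (if i = k then of_nat n else 0)"
proof -
  \<comment> \<open>A quotient is used because k - i may be negative.\<close>
  define r where "r = \<alpha> ^ k / \<alpha> ^ i"
  have "(\<Sum>c<n. (\<alpha> ^ c) ^ k * \<beta> c ^ i) = (\<Sum>c<n. r ^ c)"
    by (rule sum.cong[OF refl])
      (simp add: r_def beta_inverse power_mult_distrib divide_inverse power_inverse mult.commute
        flip: power_mult)
  also have "\<dots> = (if i = k then of_nat n else 0)"
  proof (cases "i = k")
    case True
    thus ?thesis using alpha_nonzero by (simp add: r_def)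
  next
    case False
    hence "\<alpha> ^ k \<noteq> \<alpha> ^ i" using assms inj_powers by (auto dest: inj_onD)
    hence "r \<noteq> 1" using alpha_nonzero by (simp add: r_def)
    moreover have "r ^ n = 1"
      by (simp add: r_def power_divide power_root)
    ultimately show ?thesis using False by (simp add: geometric_sum)
  qed
  finally show ?thesis .
qed

text \<open>Since \<open>\<beta> c ^ k = \<beta> k ^ c\<close>, base index and exponent can be
  exchanged, which reduces this dual relation to \<open>orthogonality\<close>.\<close>

lemma orthogonality':
  assumes "c < n" "d < n"
  shows "(\<Sum>k<n. (\<alpha> ^ d) ^ k * \<beta> c ^ k) = (if c = d then of_nat n else 0)"
proof -
  have "(\<Sum>k<n. (\<alpha> ^ d) ^ k * \<beta> c ^ k) = (\<Sum>k<n. (\<alpha> ^ k) ^ d * \<beta> k ^ c)"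
    by (rule sum.cong[OF refl])
      (use assms in \<open>simp add: beta_inverse power_inverse mult.commute flip: power_mult\<close>)
  thus ?thesis using orthogonality[OF assms] by simp
qed

section \<open>Inversion of the discrete Fourier transform\<close>

text \<open>Swapping the sums leaves an orthogonality relation. The bound m admits a truncated
  coefficient family; the n - 1 rows of \<open>H_min\<close> call for m = n - 1.\<close>

lemma dft_inversion:
  fixes u :: "nat \<Rightarrow> 'a poly"
  assumes "m \<le> n" "k < m"
  shows "(\<Sum>c<n. smult ((\<alpha> ^ c) ^ k) (\<Sum>i<m. smult (\<beta> c ^ i) (u i))) = smult (of_nat n) (u k)"
proof -
  have "(\<Sum>c<n. smult ((\<alpha> ^ c) ^ k) (\<Sum>i<m. smult (\<beta> c ^ i) (u i))) =
      (\<Sum>c<n. \<Sum>i<m. smult ((\<alpha> ^ c) ^ k * \<beta> c ^ i) (u i))"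
    by (simp add: smult_sum_right)
  also have "\<dots> = (\<Sum>i<m. smult (\<Sum>c<n. (\<alpha> ^ c) ^ k * \<beta> c ^ i) (u i))"
    by (subst sum.swap) (simp add: smult_sum)
  also have "\<dots> = (\<Sum>i<m. if i = k then smult (of_nat n) (u k) else 0)"
    by (rule sum.cong) (use assms orthogonality in auto)
  finally show ?thesis using assms by simp
qed

text \<open>Here the kernels come in the opposite order: prescribed \<beta>-power sums are realised
  by a transform, as the construction of a right inverse requires.\<close>

lemma dft_inversion':
  fixes x :: "nat \<Rightarrow> 'a poly"
  assumes "i < n"
  shows "(\<Sum>c<n. smult (\<beta> c ^ i) (\<Sum>k<n. smult ((\<alpha> ^ c) ^ k) (x k))) = smult (of_nat n) (x i)"
proof -
  have "(\<Sum>c<n. smult (\<beta> c ^ i) (\<Sum>k<n. smult ((\<alpha> ^ c) ^ k) (x k))) =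
      (\<Sum>c<n. \<Sum>k<n. smult ((\<alpha> ^ c) ^ k * \<beta> c ^ i) (x k))"
    by (simp add: smult_sum_right mult.commute)
  also have "\<dots> = (\<Sum>k<n. smult (\<Sum>c<n. (\<alpha> ^ c) ^ k * \<beta> c ^ i) (x k))"
    by (subst sum.swap) (simp add: smult_sum)
  also have "\<dots> = (\<Sum>k<n. if k = i then smult (of_nat n) (x i) else 0)"
    by (rule sum.cong) (use assms orthogonality in auto)
  finally show ?thesis using assms by simp
qed

text \<open>The dual direction, from \<beta>-power sums back to the values, rests on
  \<open>orthogonality'\<close> and serves to analyse kernel vectors of
  \<open>H_min\<close>.\<close>

lemma dft_inversion'':
  fixes w :: "nat \<Rightarrow> 'a poly"
  assumes "d < n"
  shows "(\<Sum>k<n. smult ((\<alpha> ^ d) ^ k) (\<Sum>c<n. smult (\<beta> c ^ k) (w c))) = smult (of_nat n) (w d)"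
proof -
  have "(\<Sum>k<n. smult ((\<alpha> ^ d) ^ k) (\<Sum>c<n. smult (\<beta> c ^ k) (w c))) =
      (\<Sum>k<n. \<Sum>c<n. smult ((\<alpha> ^ d) ^ k * \<beta> c ^ k) (w c))"
    by (simp add: smult_sum_right)
  also have "\<dots> = (\<Sum>c<n. smult (\<Sum>k<n. (\<alpha> ^ d) ^ k * \<beta> c ^ k) (w c))"
    by (subst sum.swap) (simp add: smult_sum)
  also have "\<dots> = (\<Sum>c<n. if c = d then smult (of_nat n) (w d) else 0)"
    by (rule sum.cong) (use assms orthogonality' in auto)
  finally show ?thesis using assms by simp
qed

section \<open>The matrix \<open>H_min\<close>: rank, right inverse and minimality\<close>

lemma dim_H_min: "dim_row (H_min \<alpha> n) = n - 1" "dim_col (H_min \<alpha> n) = n"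
  by (simp_all add: H_min_def)

lemma H_min_entry:
  "i < n - 1 \<Longrightarrow> c < n \<Longrightarrow> H_min \<alpha> n $$ (i, c) = smult (\<beta> c ^ i) (lin c)"
  by (simp add: H_min_def mult.commute)

lemma row_mult_H_min:
  assumes "c < n"
  shows "row_mult u (H_min \<alpha> n) $ c = (\<Sum>i<n - 1. smult (\<beta> c ^ i) (u $ i)) * lin c"
  using assms by (simp add: row_mult_def dim_H_min H_min_entry sum_distrib_right del: mult_pCons_right smult_pCons)

text \<open>Entry c is a multiple of the linear polynomial \<open>lin c\<close>, so it is constant
  only if its cofactor vanishes. The cofactors are the transform of u, whence u = 0. Both full row
  rank and the degree bound for minimality follow from this.\<close>

lemma row_mult_H_min_const:
  assumes const: "\<And>c. c < n \<Longrightarrow> degree (row_mult u (H_min \<alpha> n) $ c) = 0"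
    and u: "u \<in> carrier_vec (n - 1)"
  shows "u = 0\<^sub>v (n - 1)"
proof (rule eq_vecI)
  have zero: "(\<Sum>i<n - 1. smult (\<beta> c ^ i) (u $ i)) = 0" if "c < n" for c
  proof (rule ccontr)
    assume "(\<Sum>i<n - 1. smult (\<beta> c ^ i) (u $ i)) \<noteq> 0"
    thus False using const[OF that]
      by (simp add: row_mult_H_min[OF that] degree_mult_eq del: mult_pCons_right)
  qed
  fix k assume "k < dim_vec (0\<^sub>v (n - 1) :: 'a poly vec)"
  hence k: "k < n - 1" by simp
  \<comment> \<open>All n transform values vanish, so inversion kills each of the n - 1 coefficients
    up to the factor n, which is nonzero in the field.\<close>
  have "smult (of_nat n) (u $ k) = 0"
    using dft_inversion[of "n - 1" k "\<lambda>i. u $ i"] zero k by simp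
  thus "u $ k = 0\<^sub>v (n - 1) $ k" using of_nat_n_nonzero k by simp
qed (use u in simp)

lemma full_row_rank_H_min: "full_row_rank (H_min \<alpha> n)"
  unfolding full_row_rank_def dim_H_min
proof (intro ballI impI)
  fix u assume "u \<in> carrier_vec (n - 1)" and "row_mult u (H_min \<alpha> n) = 0\<^sub>v n"
  thus "u = 0\<^sub>v (n - 1)" by (intro row_mult_H_min_const) simp_all
qed

text \<open>With column vector N = (1/n) * (DFT of x), the product H_min N has entries z x_i - x_(i+1);
  solving this recurrence for the j-th unit vector gives the witness below.\<close>
lemma right_invertible_H_min: "right_invertible (H_min \<alpha> n)"
proof -
  define x :: "nat \<Rightarrow> nat \<Rightarrow> 'a poly"
    where "x j k = (if j < k then - monom 1 (k - j - 1) else 0)" for j k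
  define N where "N = mat n (n - 1)
    (\<lambda>(c, j). smult (inverse (of_nat n)) (\<Sum>k<n. smult ((\<alpha> ^ c) ^ k) (x j k)))"
  have N: "N \<in> carrier_mat n (n - 1)" by (simp add: N_def)
  have dft: "(\<Sum>c<n. smult (\<beta> c ^ i) (N $$ (c, j))) = x j i" if "i < n" "j < n - 1" for i j
  proof -
    have "(\<Sum>c<n. smult (\<beta> c ^ i) (N $$ (c, j))) = smult (inverse (of_nat n))
        (\<Sum>c<n. smult (\<beta> c ^ i) (\<Sum>k<n. smult ((\<alpha> ^ c) ^ k) (x j k)))"
      unfolding smult_sum_right[of "inverse (of_nat n)"] using that
      by (intro sum.cong) (auto simp: N_def mult.commute)
    thus ?thesis using that of_nat_n_nonzero by (simp add: dft_inversion')
  qed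
  have "H_min \<alpha> n * N = 1\<^sub>m (n - 1)"
  proof (rule eq_matI)
    fix i j assume "i < dim_row (1\<^sub>m (n - 1) :: 'a poly mat)" "j < dim_col (1\<^sub>m (n - 1) :: 'a poly mat)"
    hence ij: "i < n - 1" "j < n - 1" by simp_all
    have "(H_min \<alpha> n * N) $$ (i, j) = (\<Sum>c<n. smult (\<beta> c ^ i) (lin c) * N $$ (c, j))"
      using ij N by (auto simp: scalar_prod_def dim_H_min H_min_entry atLeast0LessThan intro!: sum.cong)
    also have "\<dots> = (\<Sum>c<n. [:0, 1:] * smult (\<beta> c ^ i) (N $$ (c, j))
        - smult (\<beta> c ^ Suc i) (N $$ (c, j)))"
      by (intro sum.cong[OF refl]) (simp add: mult.commute)
    \<comment> \<open>Multiplying by z - \<open>\<beta> c\<close> mixes the exponents i and i + 1.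
      As i < n - 1, both stay below n and \<open>dft\<close> applies to each; the missing last
      Vandermonde row makes room for the shift.\<close>
    also have "\<dots> = [:0, 1:] * x j i - x j (Suc i)"
      using dft[of i j] dft[of "Suc i" j] ij
      by (simp only: sum_subtractf flip: sum_distrib_left)
    also have "\<dots> = (if i = j then 1 else 0)"
    proof (cases i j rule: linorder_cases)
      case greater
      hence "Suc i - j - 1 = Suc (i - j - 1)" by simp
      thus ?thesis using greater by (simp add: x_def monom_Suc)
    qed (auto simp: x_def)
    finally show "(H_min \<alpha> n * N) $$ (i, j) = 1\<^sub>m (n - 1) $$ (i, j)" using ij by simp
  qed (use N in \<open>auto simp: dim_H_min\<close>)
  thus ?thesis unfolding right_invertible_def dim_H_min using N by blast
qed

text \<open>Every nonzero vector of the row module has degree at least 1, and every basis has n - 1 rows,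
  so degree sum n - 1 is optimal.\<close>
lemma minimal_H_min: "minimal_mat (H_min \<alpha> n)"
  unfolding minimal_mat_def
proof (intro conjI allI impI)
  show "full_row_rank (H_min \<alpha> n)" by (rule full_row_rank_H_min)
  fix B assume "rows_basis_of B (H_min \<alpha> n)"
  hence dc: "dim_col B = n" and frr: "full_row_rank B"
    and img: "row_image B = row_image (H_min \<alpha> n)"
    by (auto simp: rows_basis_of_def dim_H_min)
  have "sum_row_degrees (H_min \<alpha> n) \<le> (\<Sum>i<n - 1. 1)"
    unfolding sum_row_degrees_def dim_H_min
    by (intro sum_mono) (auto simp: row_degree_le_iff dim_H_min H_min_entry)
  also have "\<dots> \<le> (\<Sum>i<dim_row B. 1)"
    using dim_row_le_of_row_image[OF right_invertible_H_min, of B] img dc by (simp add: dim_H_min)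
  also have "\<dots> \<le> sum_row_degrees B"
    unfolding sum_row_degrees_def
  proof (rule sum_mono, rule ccontr)
    fix i assume "i \<in> {..<dim_row B}" and "\<not> 1 \<le> row_degree B i"
    hence i: "i < dim_row B" and deg: "\<And>c. c < n \<Longrightarrow> degree (row B i $ c) = 0"
      using row_degree_le_iff[of B i 0] dc by auto
    obtain u where u: "u \<in> carrier_vec (n - 1)" "row B i = row_mult u (H_min \<alpha> n)"
      using row_in_row_image[OF i] img unfolding row_image_def dim_H_min by auto
    have "u = 0\<^sub>v (n - 1)" using row_mult_H_min_const[of u] deg u by simp
    hence "row B i = 0\<^sub>v (dim_col B)"
      using u(2) by (auto simp: dc row_mult_def dim_H_min intro!: eq_vecI)
    thus False using full_row_rank_row_nonzero[OF frr i] by simp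
  qed
  finally show "sum_row_degrees (H_min \<alpha> n) \<le> sum_row_degrees B" .
qed

section \<open>The generator \<open>G_mat\<close> and the kernel of \<open>H_min\<close>\<close>

lemma dim_G_mat: "dim_row (G_mat \<alpha> n) = 1" "dim_col (G_mat \<alpha> n) = n"
  by (simp_all add: G_mat_def)

text \<open>Entry c is the geometric sum in q = \<alpha>^c z, and \<open>lin c\<close> is
  \<open>\<beta> c\<close> times q - 1, so the product telescopes to q^n - 1 with q^n = z^n.\<close>

lemma G_mat_mult_lin:
  assumes "c < n"
  shows "G_mat \<alpha> n $$ (0, c) * lin c = smult (\<beta> c) (monom 1 n - 1)"
proof -
  define q where "q = monom (\<alpha> ^ c) 1"
  have G: "G_mat \<alpha> n $$ (0, c) = (\<Sum>\<nu><n. q ^ \<nu>)"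
    using assms by (auto simp: G_mat_def q_def monom_power mult.commute simp flip: power_mult intro!: sum.cong)
  have "lin c = smult (\<beta> c) (q - 1)"
    using assms alpha_nonzero
    by (simp add: beta_inverse q_def monom_altdef one_pCons)
  hence "G_mat \<alpha> n $$ (0, c) * lin c = smult (\<beta> c) ((q - 1) * (\<Sum>\<nu><n. q ^ \<nu>))"
    by (simp only: G mult_smult_right mult.commute)
  also have "(q - 1) * (\<Sum>\<nu><n. q ^ \<nu>) = q ^ n - 1"
    by (rule power_diff_1_eq[symmetric])
  also have "q ^ n = monom 1 n"
    by (simp add: q_def monom_power power_root)
  finally show ?thesis .
qed

lemma row_mult_transpose_H_min:
  assumes "i < n - 1"
  shows "row_mult v (transpose_mat (H_min \<alpha> n)) $ i = (\<Sum>c<n. smult (\<beta> c ^ i) (v $ c * lin c))"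
  using assms
  by (auto simp: row_mult_def dim_H_min H_min_entry simp del: mult_pCons_right smult_pCons intro!: sum.cong)

text \<open>The exponent i + 1 lies strictly between 0 and n, so it is orthogonal to exponent
  0.\<close>

lemma sum_beta_powers:
  assumes "i < n - 1"
  shows "(\<Sum>c<n. \<beta> c ^ Suc i) = 0"
  using orthogonality[of "Suc i" 0] assms by simp

text \<open>After multiplication by \<open>lin c\<close> all entries of G share the factor z^n - 1,
  and only a vanishing power sum of the \<beta> remains.\<close>

lemma sum_G_mat_H_min:
  assumes "i < n - 1"
  shows "(\<Sum>c<n. smult (\<beta> c ^ i) (G_mat \<alpha> n $$ (0, c) * lin c)) = 0"
proof -
  have "(\<Sum>c<n. smult (\<beta> c ^ i) (G_mat \<alpha> n $$ (0, c) * lin c)) =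
      (\<Sum>c<n. smult (\<beta> c ^ Suc i) (monom 1 n - 1))"
    by (rule sum.cong) (auto simp: G_mat_mult_lin mult.commute simp del: mult_pCons_right)
  also have "\<dots> = smult (\<Sum>c<n. \<beta> c ^ Suc i) (monom 1 n - 1)"
    by (simp only: smult_sum)
  finally show ?thesis using sum_beta_powers[OF assms] by simp
qed

lemma G_mat_mult_transpose_H_min:
  "G_mat \<alpha> n * transpose_mat (H_min \<alpha> n) = 0\<^sub>m 1 (n - 1)"
proof (rule eq_matI)
  fix r i assume "r < dim_row (0\<^sub>m 1 (n - 1) :: 'a poly mat)" "i < dim_col (0\<^sub>m 1 (n - 1) :: 'a poly mat)"
  hence r: "r = 0" and i: "i < n - 1" by simp_all
  have "(G_mat \<alpha> n * transpose_mat (H_min \<alpha> n)) $$ (0, i) =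
      (\<Sum>c<n. smult (\<beta> c ^ i) (G_mat \<alpha> n $$ (0, c) * lin c))"
    using i by (auto simp: scalar_prod_def dim_H_min dim_G_mat H_min_entry atLeast0LessThan
        simp del: mult_pCons_right smult_pCons intro!: sum.cong)
  thus "(G_mat \<alpha> n * transpose_mat (H_min \<alpha> n)) $$ (r, i) = 0\<^sub>m 1 (n - 1) $$ (r, i)"
    using r i sum_G_mat_H_min by simp
qed (simp_all add: dim_H_min dim_G_mat)

text \<open>The remainder modulo z^n - 1 has degree below n but vanishes at the n distinct points
  \<open>\<beta> c\<close>, so it is zero.\<close>

lemma dvd_of_power_roots:
  assumes "\<And>c. c < n \<Longrightarrow> poly p (\<beta> c) = 0"
  shows "monom 1 n - 1 dvd p"
proof -
  let ?q = "monom 1 n - 1 :: 'a poly"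
  have deg: "degree ?q = n" 
    using n_pos by (subst diff_conv_add_uminus, subst degree_add_eq_left) (auto simp: degree_monom_eq)
  hence "?q \<noteq> 0" using n_pos by auto
  have "p mod ?q = 0"
  proof (rule poly_eqI_degree[of "\<beta> ` {..<n}"])
    fix x assume "x \<in> \<beta> ` {..<n}"
    then obtain c where c: "c < n" "x = \<beta> c" by auto
    have "poly (p div ?q * ?q + p mod ?q) x = 0"
      using assms c by (simp only: div_mult_mod_eq)
    \<comment> \<open>The divisor vanishes at x because x^n = 1, so p and its remainder agree
      there.\<close>
    thus "poly (p mod ?q) x = poly 0 x"
      using c power_root by (simp add: poly_monom)
  qed (use degree_mod_less[OF \<open>?q \<noteq> 0\<close>, of p] deg n_pos inj_beta in \<open>auto simp: card_image\<close>)
  thus ?thesis by (simp add: dvd_eq_mod_eq_0)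
qed

lemma row_mult_G_mat:
  assumes "c < n"
  shows "row_mult u (G_mat \<alpha> n) $ c = u $ 0 * G_mat \<alpha> n $$ (0, c)"
  using assms by (simp add: row_mult_def dim_G_mat)

lemma row_image_G_mat:
  "row_image (G_mat \<alpha> n) =
    {v \<in> carrier_vec n. row_mult v (transpose_mat (H_min \<alpha> n)) = 0\<^sub>v (n - 1)}"
proof (intro equalityI subsetI)
  fix v assume "v \<in> row_image (G_mat \<alpha> n)"
  then obtain u where v: "v = row_mult u (G_mat \<alpha> n)"
    unfolding row_image_def by auto
  have "row_mult v (transpose_mat (H_min \<alpha> n)) = 0\<^sub>v (n - 1)"
  proof (rule eq_vecI)
    fix i assume "i < dim_vec (0\<^sub>v (n - 1) :: 'a poly vec)"
    hence i: "i < n - 1" by simp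
    have "row_mult v (transpose_mat (H_min \<alpha> n)) $ i =
        u $ 0 * (\<Sum>c<n. smult (\<beta> c ^ i) (G_mat \<alpha> n $$ (0, c) * lin c))"
      unfolding row_mult_transpose_H_min[OF i] sum_distrib_left
      by (rule sum.cong) (auto simp: v row_mult_G_mat mult.assoc simp del: mult_pCons_right)
    thus "row_mult v (transpose_mat (H_min \<alpha> n)) $ i = 0\<^sub>v (n - 1) $ i"
      using i unfolding sum_G_mat_H_min[OF i] by simp
  qed (simp add: row_mult_def dim_H_min)
  moreover have "v \<in> carrier_vec n" by (simp add: v row_mult_def dim_G_mat carrier_vecI)
  ultimately show "v \<in> {v \<in> carrier_vec n. row_mult v (transpose_mat (H_min \<alpha> n)) = 0\<^sub>v (n - 1)}"
    by simp
next
  fix v assume "v \<in> {v \<in> carrier_vec n. row_mult v (transpose_mat (H_min \<alpha> n)) = 0\<^sub>v (n - 1)}"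
  hence v: "v \<in> carrier_vec n" and ker: "row_mult v (transpose_mat (H_min \<alpha> n)) = 0\<^sub>v (n - 1)"
    by auto
  \<comment> \<open>For k < n - 1 these are the entries of the product of v with the transpose of
    \<open>H_min\<close>; k = n - 1 supplies the Vandermonde row absent from
    \<open>H_min\<close>.\<close>
  define s where "s k = (\<Sum>c<n. smult (\<beta> c ^ k) (v $ c * lin c))" for k
  define \<mu> where "\<mu> = smult (inverse (of_nat n)) (s (n - 1))"
  have s0: "s k = 0" if "k < n - 1" for k
    using row_mult_transpose_H_min[OF that, of v] ker that by (simp add: s_def)
  have eq: "v $ d * lin d = smult (\<beta> d) \<mu>" if d: "d < n" for d
  proof -
    have "smult (of_nat n) (v $ d * lin d) = (\<Sum>k<n. smult ((\<alpha> ^ d) ^ k) (s k))"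
      using dft_inversion''[OF d, of "\<lambda>c. v $ c * lin c"] by (simp only: s_def)
    \<comment> \<open>Only the unconstrained exponent n - 1 survives, and its kernel value
      (\<alpha>^d)^(n-1) is \<alpha>^(-d).\<close>
    also have "\<dots> = (\<Sum>k\<in>{n - 1}. smult ((\<alpha> ^ d) ^ k) (s k))"
      by (rule sum.mono_neutral_right) (use n_pos in \<open>auto intro!: s0\<close>)
    also have "\<dots> = smult ((\<alpha> ^ d) ^ (n - 1)) (s (n - 1))" by simp
    also have "(\<alpha> ^ d) ^ (n - 1) = \<beta> d"
    proof -
      have "(\<alpha> ^ d) ^ (n - 1) * \<alpha> ^ d = (\<alpha> ^ n) ^ d"
        using n_pos by (metis mult.commute power_mult power_minus_mult)
      thus ?thesis using d alpha_nonzero by (simp add: root beta_inverse field_simps)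
    qed
    finally have "smult (inverse (of_nat n)) (smult (of_nat n) (v $ d * lin d)) =
        smult (inverse (of_nat n)) (smult (\<beta> d) (s (n - 1)))" by (rule arg_cong)
    thus ?thesis
      using of_nat_n_nonzero by (simp add: \<mu>_def mult.commute del: mult_pCons_right)
  qed
  \<comment> \<open>Evaluating \<open>eq\<close> at \<open>\<beta> d\<close> makes the left side
    vanish, and the factor \<open>\<beta> d\<close> on the right is nonzero.\<close>
  have "poly \<mu> (\<beta> d) = 0" if "d < n" for d
    using arg_cong[OF eq[OF that], of "\<lambda>p. poly p (\<beta> d)"] alpha_nonzero by simp
  then obtain \<kappa> where \<kappa>: "\<mu> = (monom 1 n - 1) * \<kappa>"
    using dvd_of_power_roots[of \<mu>] by (auto elim: dvdE)
  have "v = row_mult (vec 1 (\<lambda>_. \<kappa>)) (G_mat \<alpha> n)"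
  proof (rule eq_vecI)
    fix c assume "c < dim_vec (row_mult (vec 1 (\<lambda>_. \<kappa>)) (G_mat \<alpha> n))"
    hence c: "c < n" by (simp add: row_mult_def dim_G_mat)
    have "v $ c * lin c = \<kappa> * smult (\<beta> c) (monom 1 n - 1)"
      by (simp only: eq[OF c] \<kappa> mult_smult_right mult.commute)
    also have "\<dots> = (\<kappa> * G_mat \<alpha> n $$ (0, c)) * lin c"
      by (simp only: G_mat_mult_lin[OF c, symmetric] mult.assoc)
    \<comment> \<open>The nonzero polynomial \<open>lin c\<close> cancels in the integral domain of
      polynomials.\<close>
    finally have "v $ c = \<kappa> * G_mat \<alpha> n $$ (0, c)"
      by (subst (asm) mult_cancel_right) simp
    thus "v $ c = row_mult (vec 1 (\<lambda>_. \<kappa>)) (G_mat \<alpha> n) $ c"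
      using c by (simp add: row_mult_G_mat)
  qed (use v in \<open>simp add: row_mult_def dim_G_mat\<close>)
  thus "v \<in> row_image (G_mat \<alpha> n)"
    unfolding row_image_def dim_G_mat by auto
qed

end

section \<open>The order of a nonzero element of a finite field\<close>

text \<open>By the pigeonhole principle two powers coincide, so some positive exponent yields 1 and
  the \<open>LEAST\<close> is attained. A coincidence among the powers below it would yield a
  smaller such exponent.\<close>

lemma primitive_root_mult_ord:
  fixes \<alpha> :: "'a::{field,finite}"
  assumes nz: "\<alpha> \<noteq> 0"
  shows "primitive_root \<alpha> (mult_ord \<alpha>)"
proof -
  define P where "P k \<longleftrightarrow> 0 < k \<and> \<alpha> ^ k = 1" for k :: nat
  have quot: "P (b - a)" if "a < b" "\<alpha> ^ a = \<alpha> ^ b" for a b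
    using that nz by (simp add: P_def power_diff)
  have "\<not> inj (\<lambda>k::nat. \<alpha> ^ k)"
    using finite_imageD[of "\<lambda>k::nat. \<alpha> ^ k" UNIV] infinite_UNIV_nat by auto
  then obtain a b :: nat where "a \<noteq> b" "\<alpha> ^ a = \<alpha> ^ b" by (auto simp: inj_def)
  hence "\<exists>k. P k" using quot by (metis linorder_neqE_nat)
  moreover have ord: "mult_ord \<alpha> = (LEAST k. P k)"
    using nz by (simp add: mult_ord_def P_def)
  ultimately have P: "P (mult_ord \<alpha>)" and least: "\<And>k. P k \<Longrightarrow> mult_ord \<alpha> \<le> k"
    by (auto intro: LeastI_ex Least_le)
  have "inj_on (\<lambda>k. \<alpha> ^ k) {..<mult_ord \<alpha>}"
  proof (rule linorder_inj_onI)
    fix a b assume "a < b" "a \<in> {..<mult_ord \<alpha>}" "b \<in> {..<mult_ord \<alpha>}"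
    thus "\<alpha> ^ a \<noteq> \<alpha> ^ b" using quot[of a b] least[of "b - a"] by auto
  qed auto
  thus ?thesis using P by unfold_locales (auto simp: P_def)
qed

theorem theorem3p3:
  fixes \<alpha> :: "'a::{field,finite}" and n :: nat
  assumes "\<alpha> \<noteq> 0" and "mult_ord \<alpha> = n"
  shows "minimal_mat (H_min \<alpha> n) \<and> right_invertible (H_min \<alpha> n)
    \<and> G_mat \<alpha> n * transpose_mat (H_min \<alpha> n) = 0\<^sub>m 1 (n - 1)
    \<and> parity_check_mat (H_min \<alpha> n) (row_image (G_mat \<alpha> n))"
proof -
  interpret primitive_root \<alpha> n
    using primitive_root_mult_ord[OF assms(1)] assms(2) by simp
  show ?thesis
    using minimal_H_min right_invertible_H_min G_mat_mult_transpose_H_min row_image_G_mat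
    by (simp add: parity_check_mat_def dim_H_min)
qed

end
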